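(* Let $p_n$ be the proportion of permutations $\gamma\in\mathcal S_n$ for which there exist $\alpha,\beta\in\mathcal S_n$ with $(\alpha,\beta,\gamma;(12))\in\mathrm{Par}(n)$. Then $p_n\to0$ as $n\to\infty$.
   Context: A Latin square of order $n$ is an $n\times n$ array with rows, columns and symbols indexed by $[n]$, each symbol occurring once in each row and each column, with triple set $O(L)$. Permutations act on the right. A paratopism $(\alpha,\beta,\gamma;(12))$ with $\alpha,\beta,\gamma\in\mathcal S_n$ maps $L$ to $L^\sigma$ with triple set $\{(y\beta,x\alpha,z\gamma):(x,y,z)\in O(L)\}$; it is an autoparatopism of $L$ if $L^\sigma=L$. $\mathrm{Par}(n)$ is the set of paratopisms that are autoparatopisms of at least one Latin square of order $n$. *)

theory Defs
  imports Complex_Main "HOL-Combinatorics.Permutations"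
begin

text \<open>Latin square of order n given by its triple set O(L) \<subseteq> [n]^3, with [n] = {1..n}:
  each cell (row, column) holds exactly one symbol, each symbol occurs exactly once
  in each row and exactly once in each column.\<close>
definition latin_square :: "nat \<Rightarrow> (nat \<times> nat \<times> nat) set \<Rightarrow> bool" where
  "latin_square n T \<longleftrightarrow>
     T \<subseteq> {1..n} \<times> {1..n} \<times> {1..n} \<and>
     (\<forall>x\<in>{1..n}. \<forall>y\<in>{1..n}. \<exists>!z. (x, y, z) \<in> T) \<and>
     (\<forall>x\<in>{1..n}. \<forall>z\<in>{1..n}. \<exists>!y. (x, y, z) \<in> T) \<and>
     (\<forall>y\<in>{1..n}. \<forall>z\<in>{1..n}. \<exists>!x. (x, y, z) \<in> T)"

text \<open>Image of a Latin square under the paratopism (\<alpha>,\<beta>,\<gamma>;(12)); permutations act on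
  the right, so x\<alpha> is written \<alpha> x.\<close>
definition paratopism12_image ::
  "(nat \<Rightarrow> nat) \<Rightarrow> (nat \<Rightarrow> nat) \<Rightarrow> (nat \<Rightarrow> nat) \<Rightarrow> (nat \<times> nat \<times> nat) set \<Rightarrow> (nat \<times> nat \<times> nat) set" where
  "paratopism12_image \<alpha> \<beta> \<gamma> T = {(\<beta> y, \<alpha> x, \<gamma> z) | x y z. (x, y, z) \<in> T}"

definition in_Par12 :: "nat \<Rightarrow> (nat \<Rightarrow> nat) \<Rightarrow> (nat \<Rightarrow> nat) \<Rightarrow> (nat \<Rightarrow> nat) \<Rightarrow> bool" where
  "in_Par12 n \<alpha> \<beta> \<gamma> \<longleftrightarrow>
     \<alpha> permutes {1..n} \<and> \<beta> permutes {1..n} \<and> \<gamma> permutes {1..n} \<and>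
     (\<exists>T. latin_square n T \<and> paratopism12_image \<alpha> \<beta> \<gamma> T = T)"

definition p_prop :: "nat \<Rightarrow> real" where
  "p_prop n = real (card {\<gamma>. \<gamma> permutes {1..n} \<and>
      (\<exists>\<alpha> \<beta>. \<alpha> permutes {1..n} \<and> \<beta> permutes {1..n} \<and> in_Par12 n \<alpha> \<beta> \<gamma>)})
    / real (card {\<gamma>. \<gamma> permutes {1..(n::nat)}})"

end

theory Submission
  imports Defs "HOL-Combinatorics.Cycles" "HOL-Computational_Algebra.Primes" "HOL-Real_Asymp.Real_Asymp"
begin

text \<open>
  The square of a paratopism of the given shape is an autotopism whose symbol permutation is the
  square of \<open>\<gamma>\<close>. Let \<open>q\<close> be a power of an odd prime \<open>r\<close> with \<open>q\<close> not dividing \<open>n\<close>. A suitable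
  power of the autotopism fixes precisely the rows, columns and symbols whose period is not
  divisible by \<open>q\<close>, and there are some of each kind because \<open>q\<close> does not divide \<open>n\<close>. They form a
  subsquare, so either no symbol or at least half of the symbols have \<open>\<gamma>\<close>-period divisible by \<open>q\<close>.

  A random \<open>\<gamma>\<close> violates this. Fix \<open>K\<close>, and consider the lengths \<open>l \<le> n\<close> with \<open>l\<^sup>2 > n\<close>, \<open>l\<close> congruent
  to 1 modulo \<open>K!\<close>, and \<open>l\<close> not dividing \<open>n\<close>. Each of them has a prime power divisor \<open>q > K\<close> not
  dividing \<open>n\<close>. The expected number \<open>\<mu>\<close> of cycles of such lengths is the sum of their reciprocals;
  it tends to infinity because the divisors \<open>d\<close> of \<open>n\<close> with \<open>d\<^sup>2 > n\<close> contribute at most 1. The number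
  of cycles is concentrated around \<open>\<mu>\<close>, whereas the expected number of those cycles for which half of
  the points have period divisible by \<open>q\<close> is at most \<open>2\<mu>/K + 2\<close>.
\<close>

subsection \<open>Moments of cycle counts\<close>

text \<open>Points are counted instead of cycles: an \<open>l\<close>-cycle contributes
  \<open>l\<close> of them, so the cardinality divided by \<open>l\<close> is the number of
  \<open>l\<close>-cycles. A marked point also singles out one of the \<open>l\<close> lists
  describing its cycle, namely \<open>support p x\<close>.\<close>

definition period_points :: "'a set \<Rightarrow> nat \<Rightarrow> ('a \<Rightarrow> 'a) \<Rightarrow> 'a set" where
  "period_points S l p = {x \<in> S. least_power p x = l}"

definition distinct_lists :: "'a set \<Rightarrow> nat \<Rightarrow> 'a list set" where
  "distinct_lists S l = {xs. length xs = l \<and> distinct xs \<and> set xs \<subseteq> S}"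

lemma finite_period_points [simp]: "finite S \<Longrightarrow> finite (period_points S l p)"
  by (simp add: period_points_def)

lemma finite_distinct_lists [simp]: "finite S \<Longrightarrow> finite (distinct_lists S l)"
  by (rule finite_subset[OF _ finite_lists_length_eq[of S l]]) (auto simp: distinct_lists_def)

lemma card_distinct_lists_times_fact:
  assumes "finite S" "l \<le> card S"
  shows "card (distinct_lists S l) * fact (card S - l) = fact (card S)"
proof -
  have "card (distinct_lists S l) = \<Prod>{card S - l + 1..card S}"
    unfolding distinct_lists_def using assms by (rule card_lists_distinct_length_eq)
  also have "\<dots> = fact (card S) div fact (card S - l)"
    by (simp add: fact_div_fact)
  finally show ?thesis
    by (simp add: fact_dvd)
qed

lemma distinct_lists_empty:
  assumes "finite S" "card S < l"
  shows "distinct_lists S l = {}"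
proof -
  have False if "xs \<in> distinct_lists S l" for xs
    using that card_mono[OF assms(1), of "set xs"] distinct_card[of xs] assms(2)
    by (auto simp: distinct_lists_def)
  then show ?thesis by blast
qed

section \<open>Gluing a cycle to a permutation of the remaining points\<close>

lemma funpow_cycle_of_list_compose:
  assumes "q permutes T" "T \<inter> set xs = {}" "x \<in> set xs"
  shows "((cycle_of_list xs \<circ> q) ^^ i) x = (cycle_of_list xs ^^ i) x"
proof (induction i)
  case (Suc i)
  have "(cycle_of_list xs ^^ i) x \<in> set xs"
    using permutes_in_image[OF permutes_funpow[OF cycle_permutes[of xs]], of i x] assms(3) by blast
  then have "q ((cycle_of_list xs ^^ i) x) = (cycle_of_list xs ^^ i) x"
    using assms(1,2) by (metis disjoint_iff permutes_not_in)
  with Suc show ?case by simp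
qed simp

lemma funpow_cycle_of_list_compose_outside:
  assumes "q permutes T" "T \<inter> set xs = {}" "y \<in> T"
  shows "((cycle_of_list xs \<circ> q) ^^ i) y = (q ^^ i) y"
proof (induction i)
  case (Suc i)
  have "(q ^^ Suc i) y \<in> T"
    using permutes_in_image[OF permutes_funpow[OF assms(1)]] assms(3) by blast
  then have "cycle_of_list xs ((q ^^ Suc i) y) = (q ^^ Suc i) y"
    using assms(2) by (intro id_outside_supp) auto
  with Suc show ?case by simp
qed simp

lemma funpow_cycle_of_list_hd:
  assumes "distinct xs" "xs \<noteq> []"
  shows "(cycle_of_list xs ^^ i) (hd xs) = xs ! (i mod length xs)"
proof -
  have "(cycle_of_list xs ^^ i) (hd xs) = hd (map (cycle_of_list xs ^^ i) xs)"
    using assms(2) by (simp add: hd_map)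
  also have "\<dots> = hd (rotate i xs)"
    by (simp add: cyclic_rotation[OF assms(1)])
  also have "\<dots> = xs ! (i mod length xs)"
    using assms(2) by (rule hd_rotate_conv_nth)
  finally show ?thesis .
qed

text \<open>Since \<open>q\<close> is the identity on \<open>set xs\<close>, successive powers of
  \<open>p\<close> send \<open>hd xs\<close> through the entries of \<open>xs\<close> in order. Thus
  the list glued in can be read off again from its first point.\<close>

lemma support_cycle_of_list_compose:
  assumes "distinct xs" "xs \<noteq> []" "q permutes T" "T \<inter> set xs = {}"
  defines "p \<equiv> cycle_of_list xs \<circ> q"
  shows "least_power p (hd xs) = length xs" and "support p (hd xs) = xs"
proof -
  have pow: "(p ^^ i) (hd xs) = xs ! (i mod length xs)" for i
    unfolding p_def using funpow_cycle_of_list_compose[OF assms(3,4)] assms(1,2)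
    by (simp add: funpow_cycle_of_list_hd)
  have hd: "hd xs = xs ! 0"
    using assms(2) by (rule hd_conv_nth)
  show lp: "least_power p (hd xs) = length xs"
    unfolding least_power_def
  proof (rule Least_equality)
    show "(p ^^ length xs) (hd xs) = hd xs \<and> 0 < length xs"
      using assms(2) pow[of "length xs"] hd by simp
    fix i assume "(p ^^ i) (hd xs) = hd xs \<and> 0 < i"
    then have i: "xs ! (i mod length xs) = xs ! 0" "0 < i"
      using pow[of i] hd by auto
    show "length xs \<le> i"
    proof (rule ccontr)
      assume "\<not> length xs \<le> i"
      then have "xs ! i = xs ! 0" "i < length xs" "0 < length xs"
        using i by auto
      then show False
        using i(2) nth_eq_iff_index_eq[OF assms(1)] by simp
    qed
  qed
  show "support p (hd xs) = xs"
    unfolding lp by (rule nth_equalityI) (auto simp: pow)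
qed

lemma least_power_cycle_of_list_compose:
  assumes "distinct xs" "q permutes T" "T \<inter> set xs = {}" "y \<in> set xs"
  shows "least_power (cycle_of_list xs \<circ> q) y = length xs"
proof -
  obtain i where i: "i < length xs" "y = xs ! i"
    using assms(4) by (metis in_set_conv_nth)
  have ne: "xs \<noteq> []" using assms(4) by auto
  \<comment> \<open>Every entry is the head of some rotation of \<open>xs\<close>, and rotating the
    list does not change the cycle.\<close>
  have y: "y = hd (rotate i xs)"
    using i ne by (simp add: hd_rotate_conv_nth)
  have "cycle_of_list xs = cycle_of_list (rotate i xs)"
    using assms(1) by (rule cycle_of_list_rotate_independent)
  then show ?thesis
    using support_cycle_of_list_compose(1)[of "rotate i xs" q T] assms ne y by simp
qed

lemma least_power_cycle_of_list_compose_outside: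
  assumes "q permutes T" "T \<inter> set xs = {}" "y \<in> T"
  shows "least_power (cycle_of_list xs \<circ> q) y = least_power q y"
  unfolding least_power_def funpow_cycle_of_list_compose_outside[OF assms] ..

text \<open>On the orbit of \<open>x\<close>, \<open>p\<close> agrees with the cycle read from
  \<open>x\<close>, so undoing that cycle after \<open>p\<close> fixes the orbit pointwise.\<close>

lemma permutes_remove_cycle:
  assumes "finite S" "p permutes S" "x \<in> S"
  shows "inv (cycle_of_list (support p x)) \<circ> p permutes S - set (support p x)"
proof -
  define c where "c = cycle_of_list (support p x)"
  have perm: "permutation p"
    using assms(1,2) permutation_permutes by blast
  have sub: "set (support p x) \<subseteq> S"
    using permutes_in_image[OF permutes_funpow[OF assms(2)]] assms(3) by auto
  have c: "c permutes set (support p x)"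
    unfolding c_def by (rule cycle_permutes)
  have "inv c \<circ> p permutes S"
    using assms(2) permutes_inv[OF permutes_subset[OF c sub]] by (rule permutes_compose)
  moreover have "(inv c \<circ> p) b = b" if "b \<in> set (support p x)" for b
    using cycle_restrict[OF perm that] permutes_inverses(2)[OF c] by (simp add: c_def)
  ultimately show ?thesis
    unfolding c_def[symmetric] by (rule permutes_superset) blast
qed

text \<open>Choosing a permutation together with a point on one of its \<open>l\<close>-cycles amounts to choosing
  the cycle, read from that point, and a permutation of the remaining points.\<close>
lemma sum_over_cycles:
  fixes F :: "'a list \<Rightarrow> ('a \<Rightarrow> 'a) \<Rightarrow> nat"
  assumes "finite S" "l > 0"
  shows "(\<Sum>p | p permutes S. \<Sum>x\<in>period_points S l p. F (support p x) p) =
    (\<Sum>xs\<in>distinct_lists S l. \<Sum>q | q permutes S - set xs. F xs (cycle_of_list xs \<circ> q))"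
proof -
  have "(\<Sum>p | p permutes S. \<Sum>x\<in>period_points S l p. F (support p x) p) =
     (\<Sum>(p, x)\<in>(SIGMA p:{p. p permutes S}. period_points S l p). F (support p x) p)"
    using assms(1) by (intro sum.Sigma) (auto simp: finite_permutations)
  also have "\<dots> = (\<Sum>(xs, q)\<in>(SIGMA xs:distinct_lists S l. {q. q permutes S - set xs}).
      F xs (cycle_of_list xs \<circ> q))"
  proof (rule sum.reindex_bij_witness[where
        j = "\<lambda>(p, x). (support p x, inv (cycle_of_list (support p x)) \<circ> p)" and
        i = "\<lambda>(xs, q). (cycle_of_list xs \<circ> q, hd xs)"], goal_cases)
    case (1 a)
    obtain p x where a: "a = (p, x)" by (cases a)
    have p: "p permutes S" "x \<in> S" "least_power p x = l"
      using 1 by (auto simp: a period_points_def)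
    have "hd (support p x) = x"
      using assms(2) p(3) by (simp add: hd_map)
    then show ?case
      by (simp only: a prod.case o_assoc permutes_inv_o(1)[OF cycle_permutes] id_o)
  next
    case (2 a)
    obtain p x where a: "a = (p, x)" by (cases a)
    have p: "p permutes S" "x \<in> S" "least_power p x = l"
      using 2 by (auto simp: a period_points_def)
    have perm: "permutation p"
      using assms(1) p(1) permutation_permutes by blast
    have "set (support p x) \<subseteq> S"
      using permutes_in_image[OF permutes_funpow[OF p(1)]] p(2) by auto
    then show ?case
      using permutes_remove_cycle[OF assms(1) p(1,2)] cycle_of_permutation[OF perm, of x] p(3)
      by (simp add: a distinct_lists_def)
  next
    case (3 b)
    obtain xs q where b: "b = (xs, q)" by (cases b)
    have xs: "distinct xs" "xs \<noteq> []" "length xs = l" "q permutes S - set xs"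
      using 3 assms(2) by (auto simp: b distinct_lists_def)
    have s: "support (cycle_of_list xs \<circ> q) (hd xs) = xs"
      using support_cycle_of_list_compose(2)[OF xs(1,2,4)] by blast
    show ?case
      by (simp only: b prod.case s o_assoc permutes_inv_o(2)[OF cycle_permutes] id_o)
  next
    case (4 b)
    obtain xs q where b: "b = (xs, q)" by (cases b)
    have xs: "distinct xs" "xs \<noteq> []" "length xs = l" "q permutes S - set xs" "set xs \<subseteq> S"
      using 4 assms(2) by (auto simp: b distinct_lists_def)
    have "cycle_of_list xs \<circ> q permutes S"
      using permutes_subset[OF xs(4)] permutes_subset[OF cycle_permutes xs(5)]
      by (intro permutes_compose) auto
    moreover have "least_power (cycle_of_list xs \<circ> q) (hd xs) = l"
      using support_cycle_of_list_compose(1)[OF xs(1,2,4)] xs(3) by blast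
    moreover have "hd xs \<in> S" using xs(2,5) by auto
    ultimately show ?case
      by (simp add: b period_points_def)
  next
    case (5 a)
    obtain p x where a: "a = (p, x)" by (cases a)
    show ?case
      by (simp only: a prod.case o_assoc permutes_inv_o(1)[OF cycle_permutes] id_o)
  qed
  also have "\<dots> = (\<Sum>xs\<in>distinct_lists S l. \<Sum>q | q permutes S - set xs. F xs (cycle_of_list xs \<circ> q))"
    using assms(1) by (intro sum.Sigma[symmetric]) (auto simp: finite_permutations)
  finally show ?thesis .
qed

section \<open>First and second moments of the numbers of points of given period\<close>

lemma sum_lists_const:
  assumes "finite S"
  shows "(\<Sum>xs\<in>distinct_lists S l. fact (card S - l)) = (if l \<le> card S then fact (card S) else (0::nat))"
  using card_distinct_lists_times_fact[OF assms, of l] distinct_lists_empty[OF assms, of l] by auto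

lemma card_permutes_Diff_list:
  assumes "finite S" "xs \<in> distinct_lists S l"
  shows "card {q. q permutes S - set xs} = fact (card S - l)"
proof -
  have "card (S - set xs) = card S - l"
    using assms by (auto simp: distinct_lists_def card_Diff_subset distinct_card)
  then show ?thesis
    using assms(1) by (intro card_permutations) auto
qed

text \<open>In probabilistic terms, a random permutation has on average one point of each possible
  period \<open>l\<close>, hence \<open>1 / l\<close> cycles of length \<open>l\<close>.\<close>

lemma sum_card_period_points:
  assumes "finite S" "l > 0"
  shows "(\<Sum>p | p permutes S. card (period_points S l p)) = (if l \<le> card S then fact (card S) else 0)"
proof -
  have "(\<Sum>p | p permutes S. card (period_points S l p)) =
    (\<Sum>xs\<in>distinct_lists S l. \<Sum>q | q permutes S - set xs. 1)"
    using sum_over_cycles[OF assms, of "\<lambda>_ _. 1"] by simp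
  also have "\<dots> = (\<Sum>xs\<in>distinct_lists S l. fact (card S - l))"
    using card_permutes_Diff_list[OF assms(1)] by (intro sum.cong) auto
  finally show ?thesis
    using sum_lists_const[OF assms(1)] by simp
qed

text \<open>Once the cycle of the first point is fixed, the second point lies either on it, which
  forces \<open>l = k\<close> and leaves \<open>l\<close> choices, or among the remaining points,
  where the first moment applies again.\<close>

lemma sum_card_period_points_mult_le:
  assumes "finite S" "l > 0" "k > 0"
  shows "(\<Sum>p | p permutes S. card (period_points S l p) * card (period_points S k p)) \<le>
    (1 + (if l = k then l else 0)) * fact (card S)"
proof -
  let ?d = "if l = k then l else 0"
  have "(\<Sum>p | p permutes S. card (period_points S l p) * card (period_points S k p)) =
    (\<Sum>xs\<in>distinct_lists S l. \<Sum>q | q permutes S - set xs.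
       card (period_points S k (cycle_of_list xs \<circ> q)))"
    using sum_over_cycles[OF assms(1,2), of "\<lambda>_ p. card (period_points S k p)"] by simp
  also have "\<dots> \<le> (\<Sum>xs\<in>distinct_lists S l. (1 + ?d) * fact (card S - l))"
  proof (rule sum_mono)
    fix xs assume xs: "xs \<in> distinct_lists S l"
    then have dist: "distinct xs" "length xs = l" "set xs \<subseteq> S"
      by (auto simp: distinct_lists_def)
    have card: "card (S - set xs) = card S - l"
      using dist assms(1) by (auto simp: card_Diff_subset distinct_card)
    have "(\<Sum>q | q permutes S - set xs. card (period_points S k (cycle_of_list xs \<circ> q))) \<le>
      (\<Sum>q | q permutes S - set xs. ?d + card (period_points (S - set xs) k q))"
    proof (rule sum_mono)
      fix q assume "q \<in> {q. q permutes S - set xs}"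
      then have q: "q permutes S - set xs" by simp
      have "period_points S k (cycle_of_list xs \<circ> q) \<subseteq>
        (if l = k then set xs else {}) \<union> period_points (S - set xs) k q"
      proof
        fix y assume y: "y \<in> period_points S k (cycle_of_list xs \<circ> q)"
        show "y \<in> (if l = k then set xs else {}) \<union> period_points (S - set xs) k q"
        proof (cases "y \<in> set xs")
          case True
          then have "least_power (cycle_of_list xs \<circ> q) y = l"
            using least_power_cycle_of_list_compose[OF dist(1) q] dist(2) by auto
          with True y show ?thesis by (auto simp: period_points_def)
        next
          case False
          with y have "y \<in> S - set xs" by (simp add: period_points_def)
          moreover from this have "least_power (cycle_of_list xs \<circ> q) y = least_power q y"
            using q by (intro least_power_cycle_of_list_compose_outside[of q "S - set xs"]) auto
          ultimately show ?thesis using y by (simp add: period_points_def)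
        qed
      qed
      then have "card (period_points S k (cycle_of_list xs \<circ> q)) \<le>
        card ((if l = k then set xs else {}) \<union> period_points (S - set xs) k q)"
        using assms(1) by (intro card_mono) auto
      also have "\<dots> \<le> card (if l = k then set xs else {}) + card (period_points (S - set xs) k q)"
        by (rule card_Un_le)
      also have "card (if l = k then set xs else {}) = ?d"
        using dist distinct_card by auto
      finally show "card (period_points S k (cycle_of_list xs \<circ> q)) \<le>
        ?d + card (period_points (S - set xs) k q)" .
    qed
    also have "\<dots> = ?d * fact (card S - l) +
        (\<Sum>q | q permutes S - set xs. card (period_points (S - set xs) k q))"
      using card_permutes_Diff_list[OF assms(1) xs] by (simp add: sum.distrib)
    \<comment> \<open>The first moment on the complement is \<open>0\<close> instead of the
      factorial when \<open>k\<close> exceeds its size, so only an upper bound results.\<close>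
    also have "\<dots> \<le> ?d * fact (card S - l) + fact (card S - l)"
      using sum_card_period_points[of "S - set xs" k] assms card by auto
    finally show "(\<Sum>q | q permutes S - set xs. card (period_points S k (cycle_of_list xs \<circ> q))) \<le>
      (1 + ?d) * fact (card S - l)" by simp
  qed
  also have "\<dots> = (1 + ?d) * (\<Sum>xs\<in>distinct_lists S l. fact (card S - l))"
    by (rule sum_distrib_left[symmetric])
  also have "\<dots> \<le> (1 + ?d) * fact (card S)"
    using sum_lists_const[OF assms(1), of l] by (intro mult_left_mono) auto
  finally show ?thesis .
qed

subsection \<open>Periods of symbols under an autoparatopism\<close>

text \<open>The cycles partition \<open>S\<close>, and the size of each is the period of its points.
  The contrapositive is what gets used: if \<open>q\<close> does not divide \<open>card S\<close>,
  some point has period not divisible by \<open>q\<close>.\<close>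

lemma dvd_card_if_dvd_least_power:
  assumes "finite S" "p permutes S" "\<And>x. x \<in> S \<Longrightarrow> q dvd least_power p x"
  shows "q dvd card S"
proof -
  have perm: "permutation p"
    using assms(1,2) permutation_permutes by blast
  let ?C = "(\<lambda>x. set (support p x)) ` S"
  have "(p ^^ i) x \<in> S" if "x \<in> S" for i x
    using permutes_in_image[OF permutes_funpow[OF assms(2)], of i x] that by blast
  then have "\<Union>?C \<subseteq> S" by auto
  moreover have "x \<in> set (support p x)" for x
    using least_power_of_permutation(2)[OF perm, of x] by force
  then have "S \<subseteq> \<Union>?C" by blast
  ultimately have U: "\<Union>?C = S" by blast
  have "card (set (support p x)) = least_power p x" for x
    using distinct_card[OF cycle_of_permutation[OF perm, of x]] by simp
  then have "\<forall>c\<in>?C. q dvd card c"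
    using assms(3) by (metis (no_types, lifting) imageE)
  moreover have "\<forall>c1\<in>?C. \<forall>c2\<in>?C. c1 \<noteq> c2 \<longrightarrow> c1 \<inter> c2 = {}"
    using disjoint_support[OF perm] unfolding disjoint_def by blast
  ultimately have "q dvd card (\<Union>?C)"
    using assms(1) U by (intro dvd_partition) simp_all
  with U show ?thesis by simp
qed

text \<open>The \<open>r\<close>-part of \<open>l\<close> is at most \<open>r ^ u\<close>, and the
  rest of \<open>l\<close> is coprime to \<open>r\<close>, so it divides \<open>m\<close>.\<close>

lemma dvd_of_not_prime_power_dvd:
  fixes l m r :: nat
  assumes "prime r" "l dvd r ^ e * m" "\<not> r ^ Suc u dvd l" "l > 0"
  shows "l dvd r ^ u * m"
proof -
  obtain l' where l: "l = r ^ multiplicity r l * l'" "\<not> r dvd l'"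
    using assms(1,4) by (elim multiplicity_decompose'[of l r, rotated 2]) auto
  have le: "multiplicity r l \<le> u"
    using assms(3) multiplicity_dvd'[of "Suc u" r l] by (meson not_less_eq_eq)
  have "coprime l' (r ^ e)"
    using l(2) assms(1) by (metis coprime_commute coprime_power_left_iff prime_imp_coprime)
  moreover have "l' dvd r ^ e * m"
    using assms(2) l(1) by (metis dvd_mult_right)
  ultimately have "l' dvd m"
    using coprime_dvd_mult_right_iff by blast
  then have "r ^ multiplicity r l * l' dvd r ^ u * m"
    using le by (intro mult_dvd_mono le_imp_power_dvd)
  then show ?thesis using l(1) by simp
qed

lemma least_power_le_card:
  assumes "finite S" "p permutes S" "x \<in> S"
  shows "least_power p x \<le> card S"
proof -
  have perm: "permutation p"
    using assms(1,2) permutation_permutes by blast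
  have "(p ^^ i) x \<in> S" for i
    using permutes_in_image[OF permutes_funpow[OF assms(2)], of i x] assms(3) by blast
  then have "card (set (support p x)) \<le> card S"
    using assms(1) by (intro card_mono) auto
  then show ?thesis
    using distinct_card[OF cycle_of_permutation[OF perm, of x]] by simp
qed

text \<open>The fixed points of an autotopism form a subsquare, and a proper subsquare has at most
  half the order.\<close>
lemma latin_square_fixed_symbols_le:
  assumes L: "latin_square n T"
    and aut: "\<And>x y z. (x, y, z) \<in> T \<Longrightarrow> (a x, b y, c z) \<in> T"
    and x0: "x0 \<in> {1..n}" "a x0 = x0" and y0: "y0 \<in> {1..n}" "b y0 = y0"
    and z1: "z1 \<in> {1..n}" "c z1 \<noteq> z1"
  shows "2 * card {z \<in> {1..n}. c z = z} \<le> n"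
proof -
  let ?S = "{z \<in> {1..n}. c z = z}" and ?C = "{y \<in> {1..n}. b y = y}"
  have T: "T \<subseteq> {1..n} \<times> {1..n} \<times> {1..n}"
    and uex: "\<forall>x\<in>{1..n}. \<forall>y\<in>{1..n}. \<exists>!z. (x, y, z) \<in> T"
    and uey: "\<forall>x\<in>{1..n}. \<forall>z\<in>{1..n}. \<exists>!y. (x, y, z) \<in> T"
    and uez: "\<forall>y\<in>{1..n}. \<forall>z\<in>{1..n}. \<exists>!x. (x, y, z) \<in> T"
    using L unfolding latin_square_def by simp_all
  have sub: "x \<in> {1..n}" "y \<in> {1..n}" "z \<in> {1..n}" if "(x, y, z) \<in> T" for x y z
    using subsetD[OF T that] by simp_all
  have ex: "\<exists>z. (x, y, z) \<in> T" if "x \<in> {1..n}" "y \<in> {1..n}" for x y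
    using uex that by meson
  have ey: "\<exists>y. (x, y, z) \<in> T" if "x \<in> {1..n}" "z \<in> {1..n}" for x z
    using uey that by meson
  have ez: "\<exists>x. (x, y, z) \<in> T" if "y \<in> {1..n}" "z \<in> {1..n}" for y z
    using uez that by meson
  have ux: "x = x'" if "(x, y, z) \<in> T" "(x', y, z) \<in> T" for x x' y z
    using bspec[OF bspec[OF uez sub(2)[OF that(1)]] sub(3)[OF that(1)]] that by blast
  have uy: "y = y'" if "(x, y, z) \<in> T" "(x, y', z) \<in> T" for x y y' z
    using bspec[OF bspec[OF uey sub(1)[OF that(1)]] sub(3)[OF that(1)]] that by blast
  have uz: "z = z'" if "(x, y, z) \<in> T" "(x, y, z') \<in> T" for x y z z'
    using bspec[OF bspec[OF uex sub(1)[OF that(1)]] sub(2)[OF that(1)]] that by blast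
  \<comment> \<open>The fixed column \<open>y0\<close> contains the moved symbol \<open>z1\<close>
    in some row \<open>x1\<close>, and that row must be moved as well.\<close>
  obtain x1 where x1: "(x1, y0, z1) \<in> T" using ez y0(1) z1(1) by blast
  have x1n: "x1 \<in> {1..n}" using x1 by (rule sub)
  have ax1: "a x1 \<noteq> x1"
  proof
    assume "a x1 = x1"
    then have "(x1, y0, c z1) \<in> T" using aut[OF x1] y0(2) by simp
    with x1 have "z1 = c z1" by (rule uz)
    with z1(2) show False by simp
  qed
  \<comment> \<open>The fixed row \<open>x0\<close> carries each fixed symbol in a fixed column, so
    fixed symbols inject into fixed columns.\<close>
  obtain f where f: "\<And>z. z \<in> {1..n} \<Longrightarrow> (x0, f z, z) \<in> T"
    using ey x0(1) by metis
  have "f ` ?S \<subseteq> ?C"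
  proof
    fix y assume "y \<in> f ` ?S"
    then obtain z where z: "y = f z" "z \<in> {1..n}" "c z = z" by blast
    then have t: "(x0, y, z) \<in> T" using f by blast
    have "(x0, b y, z) \<in> T" using aut[OF t] x0(2) z(3) by simp
    then have "b y = y" using t by (rule uy)
    then show "y \<in> ?C" using sub(2)[OF t] by blast
  qed
  moreover have "inj_on f ?S"
  proof (rule inj_onI)
    fix z z' assume "z \<in> ?S" "z' \<in> ?S" "f z = f z'"
    then have "(x0, f z, z) \<in> T" "(x0, f z, z') \<in> T" using f[of z] f[of z'] by simp_all
    then show "z = z'" by (rule uz)
  qed
  ultimately have 1: "card ?S \<le> card ?C"
    by (intro card_inj_on_le[of f]) auto
  \<comment> \<open>In the moved row \<open>x1\<close> a fixed column cannot hold a fixed symbol,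
    because column and symbol determine the row. Hence fixed columns inject into moved
    symbols.\<close>
  obtain g where g: "\<And>y. y \<in> {1..n} \<Longrightarrow> (x1, y, g y) \<in> T"
    using ex x1n by metis
  have "g ` ?C \<subseteq> {1..n} - ?S"
  proof
    fix z assume "z \<in> g ` ?C"
    then obtain y where y: "z = g y" "y \<in> {1..n}" "b y = y" by blast
    then have t: "(x1, y, z) \<in> T" using g by blast
    have "c z \<noteq> z"
    proof
      assume "c z = z"
      then have "(a x1, y, z) \<in> T" using aut[OF t] y(3) by simp
      then have "a x1 = x1" using t by (rule ux)
      with ax1 show False by simp
    qed
    then show "z \<in> {1..n} - ?S" using sub(3)[OF t] by blast
  qed
  moreover have "inj_on g ?C"
  proof (rule inj_onI)
    fix y y' assume "y \<in> ?C" "y' \<in> ?C" "g y = g y'"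
    then have "(x1, y, g y) \<in> T" "(x1, y', g y) \<in> T" using g[of y] g[of y'] by simp_all
    then show "y = y'" by (rule uy)
  qed
  ultimately have "card ?C \<le> card ({1..n} - ?S)"
    by (intro card_inj_on_le[of g]) auto
  also have "\<dots> = n - card ?S"
    by (subst card_Diff_subset) auto
  finally show ?thesis using 1 x0(1) by auto
qed

lemma Par12_prime_power_periods:
  assumes par: "in_Par12 n \<alpha> \<beta> \<gamma>" and r: "prime r" "odd r" and n: "\<not> r ^ Suc u dvd n"
    and z1: "z1 \<in> {1..n}" "r ^ Suc u dvd least_power \<gamma> z1"
  shows "n \<le> 2 * card {z \<in> {1..n}. r ^ Suc u dvd least_power \<gamma> z}"
proof -
  obtain T where perms: "\<alpha> permutes {1..n}" "\<beta> permutes {1..n}" "\<gamma> permutes {1..n}"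
    and L: "latin_square n T" and im: "paratopism12_image \<alpha> \<beta> \<gamma> T = T"
    using par unfolding in_Par12_def by blast
  have step: "(\<beta> y, \<alpha> x, \<gamma> z) \<in> T" if "(x, y, z) \<in> T" for x y z
    using that im unfolding paratopism12_image_def by blast
  obtain m where m: "fact n = r ^ multiplicity r (fact n :: nat) * m" "\<not> r dvd m"
    using r(1) by (elim multiplicity_decompose'[of "fact n" r, rotated 2]) auto
  \<comment> \<open>\<open>M\<close> is \<open>fact n\<close> with its power of \<open>r\<close>
    replaced by \<open>r ^ u\<close>. It is a multiple of every period not divisible by
    \<open>r ^ Suc u\<close>, but not of \<open>r ^ Suc u\<close> itself.\<close>
  define M where "M = r ^ u * m"
  \<comment> \<open>Applying the paratopism twice restores the roles of rows and columns and gives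
    an autotopism; here its \<open>i\<close>-th power is taken.\<close>
  have aut: "(((\<beta> \<circ> \<alpha>) ^^ i) x, ((\<alpha> \<circ> \<beta>) ^^ i) y, (\<gamma> ^^ (2 * i)) z) \<in> T"
    if "(x, y, z) \<in> T" for x y z i
    using that by (induction i) (auto dest: step)
  have perm: "permutation p" if "p permutes {1..n}" for p
    using that permutation_permutes by blast
  have dvd: "least_power p x dvd M"
    if "p permutes {1..n}" "x \<in> {1..n}" "\<not> r ^ Suc u dvd least_power p x" for p x
  proof -
    have "least_power p x dvd fact n"
      using least_power_le_card[OF _ that(1,2)] least_power_of_permutation(2)[OF perm[OF that(1)], of x]
      by (intro dvd_fact) auto
    then show ?thesis
      unfolding M_def using dvd_of_not_prime_power_dvd[OF r(1) _ that(3)] m(1)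
        least_power_of_permutation(2)[OF perm[OF that(1)]] by metis
  qed
  \<comment> \<open>Rows and columns only need one fixed point each, which exists because
    \<open>r ^ Suc u\<close> does not divide \<open>n\<close>.\<close>
  have fixed: "\<exists>x\<in>{1..n}. (p ^^ M) x = x" if p: "p permutes {1..n}" for p
  proof -
    have "\<exists>x\<in>{1..n}. \<not> r ^ Suc u dvd least_power p x"
    proof (rule ccontr)
      assume "\<not> ?thesis"
      then have "r ^ Suc u dvd card {1..n}"
        using p by (intro dvd_card_if_dvd_least_power[of _ p]) blast+
      with n show False by simp
    qed
    then show ?thesis
      using dvd[OF p] least_power_dvd[OF perm[OF p]] by blast
  qed
  \<comment> \<open>For symbols the fixed points are determined exactly. The exponent carries a
    factor 2 from squaring, which is harmless because \<open>r\<close> is odd.\<close>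
  have \<gamma>: "(\<gamma> ^^ (2 * M)) z = z \<longleftrightarrow> \<not> r ^ Suc u dvd least_power \<gamma> z" if "z \<in> {1..n}" for z
  proof
    assume "(\<gamma> ^^ (2 * M)) z = z"
    then have l: "least_power \<gamma> z dvd 2 * M"
      using least_power_dvd[OF perm[OF perms(3)]] by blast
    show "\<not> r ^ Suc u dvd least_power \<gamma> z"
    proof
      assume "r ^ Suc u dvd least_power \<gamma> z"
      then have "r ^ Suc u dvd 2 * M"
        using l dvd_trans by blast
      then have "r ^ u * r dvd r ^ u * (2 * m)"
        by (simp add: M_def mult.commute mult.left_commute)
      then have "r dvd 2 * m"
        using r(1) by (simp add: prime_gt_0_nat)
      then show False
        using m(2) r by (metis prime_dvd_mult_iff primes_dvd_imp_eq two_is_prime_nat even_numeral dvd_refl)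
    qed
  next
    assume "\<not> r ^ Suc u dvd least_power \<gamma> z"
    then have "least_power \<gamma> z dvd 2 * M"
      using dvd[OF perms(3) that] by simp
    then show "(\<gamma> ^^ (2 * M)) z = z"
      using least_power_dvd[OF perm[OF perms(3)]] by blast
  qed
  obtain x0 where x0: "x0 \<in> {1..n}" "((\<beta> \<circ> \<alpha>) ^^ M) x0 = x0"
    using fixed[OF permutes_compose[OF perms(1,2)]] by blast
  obtain y0 where y0: "y0 \<in> {1..n}" "((\<alpha> \<circ> \<beta>) ^^ M) y0 = y0"
    using fixed[OF permutes_compose[OF perms(2,1)]] by blast
  have "2 * card {z \<in> {1..n}. (\<gamma> ^^ (2 * M)) z = z} \<le> n"
    using \<gamma>[OF z1(1)] z1
    by (intro latin_square_fixed_symbols_le[where a = "(\<beta> \<circ> \<alpha>) ^^ M" and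
          b = "(\<alpha> \<circ> \<beta>) ^^ M", OF L aut x0 y0 z1(1)]) auto
  moreover have eq: "{z \<in> {1..n}. (\<gamma> ^^ (2 * M)) z = z} =
      {1..n} - {z \<in> {1..n}. r ^ Suc u dvd least_power \<gamma> z}"
    using \<gamma> by blast
  have "card {z \<in> {1..n}. (\<gamma> ^^ (2 * M)) z = z} =
      card {1..n} - card {z \<in> {1..n}. r ^ Suc u dvd least_power \<gamma> z}"
    unfolding eq by (rule card_Diff_subset) auto
  ultimately show ?thesis by simp
qed

subsection \<open>Divisible periods in random permutations\<close>

text \<open>As \<open>l\<close> does not divide \<open>n\<close>, some prime has larger multiplicity
  in \<open>l\<close> than in \<open>n\<close>. A prime up to \<open>K\<close> divides
  \<open>fact K\<close>, so it cannot divide a number congruent to 1 modulo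
  \<open>fact K\<close>.\<close>

lemma ex_prime_power_dvd_not_dvd:
  fixes l n K :: nat
  assumes "2 \<le> K" "l mod fact K = 1" "\<not> l dvd n"
  obtains r u where "prime r" "odd r" "r ^ Suc u dvd l" "\<not> r ^ Suc u dvd n" "K < r ^ Suc u"
proof -
  have l: "l \<noteq> 0" and n: "n \<noteq> 0" using assms(2,3) by (auto intro: ccontr)
  obtain r where r: "prime r" "\<not> multiplicity r l \<le> multiplicity r n"
    using multiplicity_le_imp_dvd[of l n] assms(3) l by blast
  then obtain u where u: "multiplicity r l = Suc u"
    by (cases "multiplicity r l") auto
  have dvd: "r ^ Suc u dvd l"
    using multiplicity_dvd[of r l] u by simp
  have ndvd: "\<not> r ^ Suc u dvd n"
    using power_dvd_iff_le_multiplicity[of n r "Suc u"] r n u prime_gt_1_nat[OF r(1)] by auto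
  have rl: "r dvd l" using dvd by (rule dvd_mult_left[of r "r ^ u", folded power_Suc])
  have K: "K < r"
  proof (rule ccontr)
    assume "\<not> K < r"
    then have "r dvd fact K"
      using prime_gt_0_nat[OF r(1)] by (intro dvd_fact) auto
    then have "r dvd l mod fact K"
      using rl by (rule dvd_mod[rotated])
    then show False using assms(2) r(1) by simp
  qed
  have "odd r" using K assms(1) r(1) prime_odd_nat by auto
  moreover have "r \<le> r ^ Suc u" using prime_ge_1_nat[OF r(1)] by (simp add: Suc_leI)
  then have "K < r ^ Suc u" using K by linarith
  ultimately show thesis using that r(1) dvd ndvd by blast
qed

lemma card_multiples_le:
  fixes q n :: nat
  assumes "q > 0"
  shows "real (card {k \<in> {1..n}. q dvd k}) \<le> real n / real q"
proof -
  have "{k \<in> {1..n}. q dvd k} \<subseteq> (*) q ` {1..n div q}"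
    using assms by (auto simp: dvd_def image_iff less_eq_div_iff_mult_less_eq mult.commute)
  then have "card {k \<in> {1..n}. q dvd k} \<le> card ((*) q ` {1..n div q})"
    by (intro card_mono) auto
  also have "\<dots> \<le> n div q"
    using card_image_le[of "{1..n div q}" "(*) q"] by simp
  finally have "card {k \<in> {1..n}. q dvd k} * q \<le> n"
    by (meson div_times_less_eq_dividend mult_le_mono1 order_trans)
  then have "real (card {k \<in> {1..n}. q dvd k}) * real q \<le> real n"
    by (metis of_nat_le_iff of_nat_mult)
  then show ?thesis
    using assms by (simp add: pos_le_divide_eq)
qed

text \<open>Splitting by the exact period makes the second-moment bound applicable to divisible
  periods.\<close>

lemma card_dvd_least_power:
  assumes "finite S" "p permutes S"
  shows "card {z \<in> S. q dvd least_power p z} = (\<Sum>k | k \<in> {1..card S} \<and> q dvd k. card (period_points S k p))"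
proof -
  have perm: "permutation p"
    using assms permutation_permutes by blast
  have "least_power p z \<in> {1..card S}" if "z \<in> S" for z
    using least_power_le_card[OF assms that] least_power_of_permutation(2)[OF perm, of z] by auto
  then have "{z \<in> S. q dvd least_power p z} =
      (\<Union>k\<in>{k. k \<in> {1..card S} \<and> q dvd k}. period_points S k p)"
    by (auto simp: period_points_def)
  also have "card \<dots> = (\<Sum>k | k \<in> {1..card S} \<and> q dvd k. card (period_points S k p))"
    using assms(1) by (intro card_UN_disjoint) (auto simp: period_points_def)
  finally show ?thesis .
qed

text \<open>Chebyshev's inequality for the number of cycles with length in \<open>B\<close>, combined with Markov's
  inequality for the same cycles, each weighted by twice the fraction of points whose period is
  divisible by \<open>q l\<close>; on \<open>G\<close> the weighted count dominates the plain one.\<close>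
lemma card_permutations_many_divisible_periods:
  fixes S :: "'a set" and q :: "nat \<Rightarrow> nat" and K :: nat
  assumes fin: "finite S" and B: "B \<subseteq> {1..card S}" and K: "K > 0"
    and q: "\<And>l. l \<in> B \<Longrightarrow> K < q l"
    and G: "G \<subseteq> {p. p permutes S}"
    and many: "\<And>p l. p \<in> G \<Longrightarrow> l \<in> B \<Longrightarrow> period_points S l p \<noteq> {} \<Longrightarrow>
      card S \<le> 2 * card {z \<in> S. q l dvd least_power p z}"
  defines "\<mu> \<equiv> (\<Sum>l\<in>B. 1 / real l)"
  assumes \<mu>: "\<mu> > 0"
  shows "real (card G) \<le> (8 / \<mu> + 4 / real K) * fact (card S)"
proof -
  define P where "P = {p. p permutes S}"
  define n where "n = card S"
  define a where "a l p = real (card (period_points S l p))" for l p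
  define D where "D r p = (\<Sum>k | k \<in> {1..n} \<and> r dvd k. a k p)" for r p
  \<comment> \<open>\<open>N p\<close> is the number of cycles of \<open>p\<close> with length in
    \<open>B\<close>; \<open>X p\<close> is the same count with each cycle weighted.\<close>
  define N where "N p = (\<Sum>l\<in>B. a l p / real l)" for p
  define X where "X p = (\<Sum>l\<in>B. a l p / real l * (2 / real n * D (q l) p))" for p
  have finB: "finite B" using B finite_subset by blast
  have finP: "finite P" unfolding P_def using fin by (rule finite_permutations)
  have Bpos: "l > 0" "l \<le> n" if "l \<in> B" for l using B that by (auto simp: n_def)
  obtain l0 where "l0 \<in> B" using \<mu> by (force simp: \<mu>_def)
  then have n: "n > 0" using Bpos[of l0] by linarith
  have a0: "a l p \<ge> 0" for l p by (simp add: a_def)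
  have D0: "D r p \<ge> 0" for r p unfolding D_def by (intro sum_nonneg a0)
  have X0: "X p \<ge> 0" for p unfolding X_def by (intro sum_nonneg mult_nonneg_nonneg divide_nonneg_nonneg a0 D0) auto
  have a1: "(\<Sum>p\<in>P. a l p) = fact n" if "l \<in> B" for l
  proof -
    have "(\<Sum>p\<in>P. a l p) = real (\<Sum>p | p permutes S. card (period_points S l p))"
      by (simp add: a_def P_def)
    then show ?thesis
      using sum_card_period_points[OF fin Bpos(1)[OF that]] Bpos(2)[OF that] by (simp add: n_def)
  qed
  have a2: "(\<Sum>p\<in>P. a l p * a k p) \<le> (1 + (if l = k then real l else 0)) * fact n"
    if "l > 0" "k > 0" for l k
  proof -
    have "(\<Sum>p\<in>P. a l p * a k p) =
        real (\<Sum>p | p permutes S. card (period_points S l p) * card (period_points S k p))"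
      by (simp add: a_def P_def)
    also have "\<dots> \<le> real ((1 + (if l = k then l else 0)) * fact (card S))"
      using sum_card_period_points_mult_le[OF fin that] by (intro of_nat_mono)
    finally show ?thesis by (auto simp: n_def algebra_simps)
  qed
  have N1: "(\<Sum>p\<in>P. N p) = \<mu> * fact n"
  proof -
    have "(\<Sum>p\<in>P. N p) = (\<Sum>l\<in>B. (\<Sum>p\<in>P. a l p) / real l)"
      unfolding N_def by (subst sum.swap) (simp add: sum_divide_distrib)
    also have "\<dots> = (\<Sum>l\<in>B. 1 / real l * fact n)"
      by (intro sum.cong) (simp_all add: a1)
    finally show ?thesis by (simp add: \<mu>_def sum_distrib_right)
  qed
  have N2: "(\<Sum>p\<in>P. (N p)\<^sup>2) \<le> (\<mu>\<^sup>2 + \<mu>) * fact n"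
  proof -
    have "(\<Sum>p\<in>P. (N p)\<^sup>2) = (\<Sum>p\<in>P. \<Sum>l\<in>B. \<Sum>k\<in>B. a l p * a k p / (real l * real k))"
      unfolding N_def power2_eq_square sum_product by (simp add: field_simps)
    also have "\<dots> = (\<Sum>l\<in>B. \<Sum>p\<in>P. \<Sum>k\<in>B. a l p * a k p / (real l * real k))"
      by (rule sum.swap)
    also have "\<dots> = (\<Sum>l\<in>B. \<Sum>k\<in>B. (\<Sum>p\<in>P. a l p * a k p) / (real l * real k))"
      by (intro sum.cong refl, subst sum.swap) (simp add: sum_divide_distrib)
    \<comment> \<open>Off the diagonal the moments are at most those of uncorrelated counts; each
      diagonal term adds an extra \<open>1 / l\<close>, in total \<mu>.\<close>
    also have "\<dots> \<le> (\<Sum>l\<in>B. \<Sum>k\<in>B. (1 + (if l = k then real l else 0)) * fact n / (real l * real k))"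
      using Bpos by (intro sum_mono divide_right_mono a2) auto
    also have "\<dots> = (\<Sum>l\<in>B. \<Sum>k\<in>B. 1 / real l * (1 / real k) * fact n + (if l = k then 1 / real l * fact n else 0))"
      using Bpos by (intro sum.cong refl) (auto simp: field_simps)
    also have "\<dots> = (\<Sum>l\<in>B. \<Sum>k\<in>B. 1 / real l * (1 / real k)) * fact n + \<mu> * fact n"
      by (simp add: sum.distrib finB sum_distrib_right \<mu>_def sum.delta)
    also have "\<dots> = (\<mu>\<^sup>2 + \<mu>) * fact n"
      unfolding \<mu>_def power2_eq_square sum_product by (simp add: algebra_simps)
    finally show ?thesis .
  qed
  \<comment> \<open>The variance is at most the mean, as for a Poisson variable.\<close>
  have var: "(\<Sum>p\<in>P. (N p - \<mu>)\<^sup>2) \<le> \<mu> * fact n"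
  proof -
    have "(\<Sum>p\<in>P. (N p - \<mu>)\<^sup>2) = (\<Sum>p\<in>P. (N p)\<^sup>2 - 2 * \<mu> * N p + \<mu>\<^sup>2)"
      by (intro sum.cong refl) (simp add: power2_eq_square algebra_simps)
    also have "\<dots> = (\<Sum>p\<in>P. (N p)\<^sup>2) - 2 * \<mu> * (\<Sum>p\<in>P. N p) + \<mu>\<^sup>2 * card P"
      by (simp add: sum.distrib sum_subtractf sum_distrib_left[symmetric])
    also have "real (card P) = fact n"
      using card_permutations[OF refl fin] by (simp add: P_def n_def)
    finally show ?thesis
      using N1 N2 by (simp add: power2_eq_square algebra_simps)
  qed
  have X1: "(\<Sum>p\<in>P. X p) \<le> (2 * \<mu> / real K + 2) * fact n"
  proof -
    have "(\<Sum>p\<in>P. X p) = (\<Sum>l\<in>B. \<Sum>p\<in>P. a l p / real l * (2 / real n * D (q l) p))"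
      unfolding X_def by (rule sum.swap)
    also have "\<dots> \<le> (\<Sum>l\<in>B. (2 / real K * (1 / real l) + 2 / real n) * fact n)"
    proof (rule sum_mono)
      fix l assume l: "l \<in> B"
      let ?M = "{k. k \<in> {1..n} \<and> q l dvd k}"
      have "(\<Sum>p\<in>P. a l p * D (q l) p) = (\<Sum>k\<in>?M. \<Sum>p\<in>P. a l p * a k p)"
        unfolding D_def sum_distrib_left by (rule sum.swap)
      also have "\<dots> \<le> (\<Sum>k\<in>?M. (1 + (if l = k then real l else 0)) * fact n)"
        using Bpos(1)[OF l] by (intro sum_mono a2) auto
      also have "\<dots> = (real (card ?M) + (if l \<in> ?M then real l else 0)) * fact n"
        by (simp add: sum_distrib_right[symmetric] sum.distrib sum.delta)
      \<comment> \<open>At most \<open>n / K\<close> periods are multiples of \<open>q l\<close>;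
        the term \<open>l\<close> covers the points of the chosen cycle itself. After scaling, the
        latter costs \<open>2 / n\<close> per length, at most 2 over all of
        \<open>B\<close>.\<close>
      also have "\<dots> \<le> (real n / real K + real l) * fact n"
      proof (intro mult_right_mono add_mono)
        have "real (card ?M) \<le> real n / real (q l)"
          using card_multiples_le[of "q l" n] q[OF l] by simp
        also have "\<dots> \<le> real n / real K"
          using q[OF l] K by (intro divide_left_mono) auto
        finally show "real (card ?M) \<le> real n / real K" .
      qed auto
      finally have *: "(\<Sum>p\<in>P. a l p * D (q l) p) \<le> (real n / real K + real l) * fact n" .
      have "(\<Sum>p\<in>P. a l p / real l * (2 / real n * D (q l) p)) =
          2 / (real l * real n) * (\<Sum>p\<in>P. a l p * D (q l) p)"
        unfolding sum_distrib_left by (intro sum.cong) (auto simp: field_simps)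
      also have "\<dots> \<le> 2 / (real l * real n) * ((real n / real K + real l) * fact n)"
        using * by (intro mult_left_mono) auto
      also have "\<dots> = (2 / real K * (1 / real l) + 2 / real n) * fact n"
        using Bpos(1)[OF l] n K by (simp add: field_simps)
      finally show "(\<Sum>p\<in>P. a l p / real l * (2 / real n * D (q l) p)) \<le>
        (2 / real K * (1 / real l) + 2 / real n) * fact n" .
    qed
    also have "\<dots> = (2 / real K * \<mu> + real (card B) * (2 / real n)) * fact n"
      by (simp add: sum_distrib_right[symmetric] sum.distrib sum_distrib_left \<mu>_def)
    also have "\<dots> \<le> (2 / real K * \<mu> + 2) * fact n"
    proof (intro mult_right_mono add_left_mono)
      have "real (card B) \<le> real n"
        using card_mono[OF _ B] by (simp add: n_def)
      then show "real (card B) * (2 / real n) \<le> 2"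
        using n by (simp add: field_simps)
    qed auto
    finally show ?thesis by simp
  qed
  \<comment> \<open>Either \<open>N p\<close> is at most half its mean, and the first summand
    reaches 1, or \<open>X p\<close> is at least \<open>N p\<close>, which exceeds half the mean,
    and the second does.\<close>
  have good: "1 \<le> 4 / \<mu>\<^sup>2 * (N p - \<mu>)\<^sup>2 + 2 / \<mu> * X p" if p: "p \<in> G" for p
  proof -
    have "N p \<le> X p"
      unfolding N_def X_def
    proof (rule sum_mono)
      fix l assume l: "l \<in> B"
      show "a l p / real l \<le> a l p / real l * (2 / real n * D (q l) p)"
      proof (cases "period_points S l p = {}")
        case False
        have "p permutes S" using p G by blast
        then have "D (q l) p = real (card {z \<in> S. q l dvd least_power p z})"
          by (simp add: D_def a_def n_def card_dvd_least_power[OF fin])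
        then have "real n \<le> 2 * D (q l) p"
          using many[OF p l False] by (simp add: n_def)
        then have "1 \<le> 2 / real n * D (q l) p"
          using n by (simp add: field_simps)
        then show ?thesis
          using mult_left_mono[of 1 "2 / real n * D (q l) p" "a l p / real l"] a0[of l p] by simp
      qed (simp add: a_def)
    qed
    show ?thesis
    proof (cases "N p \<le> \<mu> / 2")
      case True
      then have "(\<mu> / 2)\<^sup>2 \<le> (\<mu> - N p)\<^sup>2"
        using \<mu> by (intro power_mono) auto
      then have "1 \<le> 4 / \<mu>\<^sup>2 * (N p - \<mu>)\<^sup>2"
        using \<mu> by (simp add: field_simps power2_commute[of "N p"])
      then show ?thesis using X0[of p] \<mu> by (simp add: add_increasing2)
    next
      case False
      with \<open>N p \<le> X p\<close> have "1 \<le> 2 / \<mu> * X p"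
        using \<mu> by (simp add: field_simps)
      then show ?thesis by (simp add: add_increasing)
    qed
  qed
  have "real (card G) = (\<Sum>p\<in>G. 1)" by simp
  also have "\<dots> \<le> (\<Sum>p\<in>G. 4 / \<mu>\<^sup>2 * (N p - \<mu>)\<^sup>2 + 2 / \<mu> * X p)"
    by (intro sum_mono good)
  also have "\<dots> \<le> (\<Sum>p\<in>P. 4 / \<mu>\<^sup>2 * (N p - \<mu>)\<^sup>2 + 2 / \<mu> * X p)"
    using G finP X0 \<mu> by (intro sum_mono2) (auto simp: P_def)
  also have "\<dots> = 4 / \<mu>\<^sup>2 * (\<Sum>p\<in>P. (N p - \<mu>)\<^sup>2) + 2 / \<mu> * (\<Sum>p\<in>P. X p)"
    by (simp add: sum.distrib sum_distrib_left)
  \<comment> \<open>The variance contributes \<open>4 / \<mu>\<close>, the weighted count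
    \<open>4 / K + 4 / \<mu>\<close>.\<close>
  also have "\<dots> \<le> 4 / \<mu>\<^sup>2 * (\<mu> * fact n) + 2 / \<mu> * ((2 * \<mu> / real K + 2) * fact n)"
    using var X1 \<mu> by (intro add_mono mult_left_mono) auto
  also have "\<dots> = (8 / \<mu> + 4 / real K) * fact n"
    using \<mu> K by (simp add: field_simps power2_eq_square)
  finally show ?thesis by (simp add: n_def)
qed

subsection \<open>Reciprocals of non-divisors\<close>

definition long_nondivisors :: "nat \<Rightarrow> nat \<Rightarrow> nat set" where
  "long_nondivisors W n = {l \<in> {1..n}. n < l\<^sup>2 \<and> l mod W = 1 \<and> \<not> l dvd n}"

text \<open>The quotient is a telescoping product of factors \<open>1 + 1 / Suc i\<close>, and
  \<open>ln (1 + x)\<close> is at most \<open>x\<close>.\<close>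

lemma sum_inverse_Suc_ge_ln:
  assumes "a \<le> b"
  shows "ln (real (Suc b) / real (Suc a)) \<le> (\<Sum>i=a..<b. 1 / real (Suc i))"
  using assms
proof (induction b rule: dec_induct)
  case (step b)
  have "1 + 1 / real (Suc b) = real (Suc (Suc b)) / real (Suc b)"
    by (simp add: field_simps)
  then have "real (Suc (Suc b)) / real (Suc a) = real (Suc b) / real (Suc a) * (1 + 1 / real (Suc b))"
    by simp
  also have "ln \<dots> = ln (real (Suc b) / real (Suc a)) + ln (1 + 1 / real (Suc b))"
    by (rule ln_mult_pos) (auto intro: add_pos_nonneg)
  finally have "ln (real (Suc (Suc b)) / real (Suc a)) =
      ln (real (Suc b) / real (Suc a)) + ln (1 + 1 / real (Suc b))" .
  also have "\<dots> \<le> (\<Sum>i=a..<b. 1 / real (Suc i)) + 1 / real (Suc b)"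
    by (intro add_mono step.IH ln_add_one_self_le_self) auto
  also have "\<dots> = (\<Sum>i=a..<Suc b. 1 / real (Suc i))"
    using step.hyps by simp
  finally show ?case .
qed simp

text \<open>The codivisors \<open>n div d\<close> are distinct and at most \<open>sqrt n\<close>, so
  there are at most \<open>sqrt n\<close> summands, each at most \<open>1 / sqrt n\<close>.\<close>

lemma sum_inverse_large_divisors_le:
  assumes "n > 0"
  shows "(\<Sum>d | d dvd n \<and> n < d\<^sup>2. 1 / real d) \<le> 1"
proof -
  let ?A = "{d. d dvd n \<and> n < d\<^sup>2}" and ?s = "nat \<lfloor>sqrt (real n)\<rfloor>"
  have le: "sqrt (real n) \<le> real d" if "d \<in> ?A" for d
    using that by (intro real_le_lsqrt) (auto simp flip: of_nat_power)
  have "(\<lambda>d. n div d) ` ?A \<subseteq> {1..?s}"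
  proof
    fix e assume "e \<in> (\<lambda>d. n div d) ` ?A"
    then obtain d where d: "d dvd n" "n < d\<^sup>2" "e = n div d" by blast
    then have n: "n = d * e" by simp
    then have "e < d" using d(2) by (auto simp: power2_eq_square)
    then have "e\<^sup>2 \<le> n" unfolding n power2_eq_square by simp
    then have "real e \<le> sqrt (real n)" by (intro real_le_rsqrt) (simp flip: of_nat_power)
    then have "e \<le> ?s" by (simp add: le_nat_floor)
    moreover have "e > 0" using n assms by (auto intro: ccontr)
    ultimately show "e \<in> {1..?s}" by simp
  qed
  moreover have "inj_on (\<lambda>d. n div d) ?A"
    using assms by (intro inj_onI) (metis (mono_tags, lifting) dvd_div_mult_self mem_Collect_eq mult_left_cancel mult_is_0 neq0_conv)
  ultimately have "card ?A \<le> card {1..?s}"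
    by (intro card_inj_on_le) auto
  then have "real (card ?A) \<le> real ?s" unfolding of_nat_le_iff by simp
  also have "\<dots> \<le> sqrt (real n)" by (intro of_nat_floor) simp
  finally have card: "real (card ?A) \<le> sqrt (real n)" .
  have "(\<Sum>d\<in>?A. 1 / real d) \<le> (\<Sum>d\<in>?A. 1 / sqrt (real n))"
    using le assms by (intro sum_mono divide_left_mono) (auto intro!: mult_pos_pos simp: dvd_pos_nat)
  also have "\<dots> = real (card ?A) / sqrt (real n)" by simp
  also have "\<dots> \<le> 1" using card assms by simp
  finally show ?thesis .
qed

lemma real_divide_le_Suc_div:
  assumes "W > 0"
  shows "real n / real W \<le> real (Suc (n div W))"
proof -
  have "n \<le> Suc (n div W) * W"
    using dividend_less_div_times[OF assms, of n] by simp
  then have "real n \<le> real (Suc (n div W)) * real W"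
    by (metis of_nat_le_iff of_nat_mult)
  then show ?thesis
    using assms by (simp add: pos_divide_le_eq)
qed

lemma sum_inverse_long_nondivisors_ge:
  assumes W: "W > 1" and n: "n > 0" and ab: "Suc (nat \<lfloor>sqrt (real n)\<rfloor>) \<le> n div W"
  shows "ln (real n / real W / (sqrt (real n) + 2)) / real W - 1 \<le> (\<Sum>l\<in>long_nondivisors W n. 1 / real l)"
proof -
  \<comment> \<open>The lengths are taken from the progression \<open>i * W + 1\<close>. Starting
    just above \<open>sqrt n\<close> ensures \<open>n < i^2\<close>, hence \<open>n < l^2\<close>;
    stopping before \<open>n div W\<close> keeps \<open>l\<close> at most \<open>n\<close>.\<close>
  let ?a = "Suc (nat \<lfloor>sqrt (real n)\<rfloor>)" and ?b = "n div W"
  let ?P = "(\<lambda>i. i * W + 1) ` {?a..<?b}" and ?D = "{d. d dvd n \<and> n < d\<^sup>2}"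
  have finD: "finite ?D"
    using n by (auto intro: finite_subset[OF _ finite_divisors_nat])
  have finL: "finite (long_nondivisors W n)" by (simp add: long_nondivisors_def)
  have "?P - ?D \<subseteq> long_nondivisors W n"
  proof
    fix l assume l: "l \<in> ?P - ?D"
    then obtain i where i: "l = i * W + 1" "?a \<le> i" "i < ?b" by (elim DiffE imageE) auto
    have "i \<le> i * W" using W by (cases W) auto
    then have il: "i \<le> l" using i(1) by linarith
    have "sqrt (real n) < real i" using i(2) by linarith
    then have "sqrt (real n) < sqrt (real (i\<^sup>2))" by simp
    then have "n < i\<^sup>2" unfolding real_sqrt_less_iff of_nat_less_iff .
    also have "i\<^sup>2 \<le> l\<^sup>2" using il by (rule power_mono) simp
    finally have 1: "n < l\<^sup>2" .
    have "Suc i * W \<le> ?b * W" using i(3) by (intro mult_right_mono) auto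
    also have "\<dots> \<le> n" by simp
    finally have "l \<le> n" using i(1) W by simp
    moreover have "l mod W = 1"
      unfolding i(1) mod_mult_self3 using W by simp
    moreover have "1 \<le> l" "\<not> l dvd n"
      using i(1) l 1 by auto
    ultimately show "l \<in> long_nondivisors W n"
      using 1 by (simp add: long_nondivisors_def)
  qed
  then have "(\<Sum>l\<in>?P - ?D. 1 / real l) \<le> (\<Sum>l\<in>long_nondivisors W n. 1 / real l)"
    using finL by (intro sum_mono2) auto
  moreover have "(\<Sum>l\<in>?P. 1 / real l) \<le> (\<Sum>l\<in>?P - ?D. 1 / real l) + (\<Sum>l\<in>?D. 1 / real l)"
  proof -
    have "(\<Sum>l\<in>?P \<inter> ?D. 1 / real l) \<le> (\<Sum>l\<in>?D. 1 / real l)"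
      using finD by (intro sum_mono2) auto
    then show ?thesis
      using sum.Int_Diff[of ?P "\<lambda>l. 1 / real l" ?D] by simp
  qed
  moreover have "(\<Sum>l\<in>?D. 1 / real l) \<le> 1" using n by (rule sum_inverse_large_divisors_le)
  moreover have "ln (real n / real W / (sqrt (real n) + 2)) / real W \<le> (\<Sum>l\<in>?P. 1 / real l)"
  proof -
    have "real n / real W \<le> real (Suc ?b)"
      using real_divide_le_Suc_div[of W n] W by simp
    moreover have "real (Suc ?a) \<le> sqrt (real n) + 2"
      using of_nat_floor[of "sqrt (real n)"] by simp
    ultimately have "real n / real W / (sqrt (real n) + 2) \<le> real (Suc ?b) / real (Suc ?a)"
      by (intro frac_le of_nat_0_le_iff) (simp_all only: of_nat_0_less_iff zero_less_Suc)
    then have "ln (real n / real W / (sqrt (real n) + 2)) \<le> ln (real (Suc ?b) / real (Suc ?a))"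
      using n W by (intro ln_mono) (auto intro!: divide_pos_pos mult_pos_pos add_nonneg_pos)
    also have "\<dots> \<le> (\<Sum>i=?a..<?b. 1 / real (Suc i))"
      using ab by (rule sum_inverse_Suc_ge_ln)
    finally have "ln (real n / real W / (sqrt (real n) + 2)) / real W \<le> (\<Sum>i=?a..<?b. 1 / real (Suc i)) / real W"
      using W by (intro divide_right_mono) auto
    also have "\<dots> = (\<Sum>i=?a..<?b. 1 / (real (Suc i) * real W))"
      by (simp add: sum_divide_distrib)
    \<comment> \<open>Enlarging \<open>i * W + 1\<close> to \<open>Suc i * W\<close> turns the sum
      over the progression into a harmonic sum divided by \<open>W\<close>.\<close>
    also have "\<dots> \<le> (\<Sum>i=?a..<?b. 1 / real (i * W + 1))"
    proof (rule sum_mono)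
      fix i
      have "real (i * W + 1) \<le> real (Suc i) * real W"
        using W by (simp add: algebra_simps)
      then show "1 / (real (Suc i) * real W) \<le> 1 / real (i * W + 1)"
        by (intro divide_left_mono mult_pos_pos) (use W in \<open>auto intro: add_pos_nonneg\<close>)
    qed
    also have "\<dots> = (\<Sum>l\<in>?P. 1 / real l)"
      using W by (subst sum.reindex) (auto intro!: inj_onI)
    finally show ?thesis .
  qed
  ultimately show ?thesis by linarith
qed

lemma sum_inverse_long_nondivisors_at_top:
  assumes W: "W > 1"
  shows "filterlim (\<lambda>n. \<Sum>l\<in>long_nondivisors W n. 1 / real l) at_top sequentially"
proof (rule filterlim_at_top_mono)
  have W': "real W > 0" using W by simp
  \<comment> \<open>With \<open>W\<close> fixed, the leading term is
    \<open>ln n / (2 * W)\<close>.\<close>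
  show "filterlim (\<lambda>n. ln (real n / real W / (sqrt (real n) + 2)) / real W - 1) at_top sequentially"
    using W' by real_asymp
  have "eventually (\<lambda>n. sqrt (real n) + 2 \<le> real n / real W) sequentially"
    using W' by real_asymp
  then show "eventually (\<lambda>n. ln (real n / real W / (sqrt (real n) + 2)) / real W - 1 \<le>
      (\<Sum>l\<in>long_nondivisors W n. 1 / real l)) sequentially"
    using eventually_gt_at_top[of 0]
  proof eventually_elim
    case (elim n)
    have "real (Suc (nat \<lfloor>sqrt (real n)\<rfloor>)) \<le> sqrt (real n) + 1"
      using of_nat_floor[of "sqrt (real n)"] by simp
    also have "\<dots> \<le> real n / real W - 1" using elim by simp
    also have "\<dots> \<le> real (n div W)"
      using real_divide_le_Suc_div[of W n] W by simp
    finally have "Suc (nat \<lfloor>sqrt (real n)\<rfloor>) \<le> n div W" unfolding of_nat_le_iff .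
    then show ?case
      using W elim by (intro sum_inverse_long_nondivisors_ge) auto
  qed
qed

subsection \<open>The proportion of admissible symbol permutations\<close>

text \<open>Each length in the set gets a prime power \<open>q l\<close> above \<open>K\<close>
  dividing it but not \<open>n\<close>. If an admissible \<gamma> has a cycle of that length, at
  least half of all symbols have period divisible by \<open>q l\<close>, as the counting bound
  requires.\<close>

lemma p_prop_le:
  assumes K: "2 \<le> K" and \<mu>: "(\<Sum>l\<in>long_nondivisors (fact K) n. 1 / real l) > 0"
  shows "p_prop n \<le> 8 / (\<Sum>l\<in>long_nondivisors (fact K) n. 1 / real l) + 4 / real K"
proof -
  let ?B = "long_nondivisors (fact K) n" and ?G = "{\<gamma>. \<gamma> permutes {1..n} \<and>
      (\<exists>\<alpha> \<beta>. \<alpha> permutes {1..n} \<and> \<beta> permutes {1..n} \<and> in_Par12 n \<alpha> \<beta> \<gamma>)}"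
  have "\<forall>l\<in>?B. \<exists>r u. prime r \<and> odd r \<and> r ^ Suc u dvd l \<and> \<not> r ^ Suc u dvd n \<and> K < r ^ Suc u"
    unfolding long_nondivisors_def using ex_prime_power_dvd_not_dvd[OF K] by blast
  then obtain r u where ru: "\<And>l. l \<in> ?B \<Longrightarrow> prime (r l) \<and> odd (r l) \<and> r l ^ Suc (u l) dvd l \<and>
      \<not> r l ^ Suc (u l) dvd n \<and> K < r l ^ Suc (u l)"
    by metis
  have "real (card ?G) \<le> (8 / (\<Sum>l\<in>?B. 1 / real l) + 4 / real K) * fact (card {1..n})"
  proof (rule card_permutations_many_divisible_periods[where q = "\<lambda>l. r l ^ Suc (u l)"])
    fix \<gamma> l assume \<gamma>: "\<gamma> \<in> ?G" and l: "l \<in> ?B" and "period_points {1..n} l \<gamma> \<noteq> {}"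
    then obtain z where z: "z \<in> {1..n}" "least_power \<gamma> z = l"
      by (auto simp: period_points_def)
    obtain \<alpha> \<beta> where "in_Par12 n \<alpha> \<beta> \<gamma>" using \<gamma> by blast
    then have "n \<le> 2 * card {z \<in> {1..n}. r l ^ Suc (u l) dvd least_power \<gamma> z}"
      using ru[OF l] z by (intro Par12_prime_power_periods) auto
    then show "card {1..n} \<le> 2 * card {z \<in> {1..n}. r l ^ Suc (u l) dvd least_power \<gamma> z}"
      by simp
  qed (use K \<mu> ru in \<open>auto simp: long_nondivisors_def\<close>)
  moreover have "real (card {\<gamma>. \<gamma> permutes {1..n}}) = fact n"
    using card_permutations[of "{1..n}" n] by simp
  ultimately show ?thesis
    unfolding p_prop_def by (simp add: pos_divide_le_eq)
qed

theorem theorem6p2: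
  shows "p_prop \<longlonglongrightarrow> 0"
proof (rule LIMSEQ_I)
  fix e :: real assume e: "e > 0"
  \<comment> \<open>\<open>K\<close> is fixed first, making \<open>4 / K\<close> less than
    \<open>e / 2\<close>. Only then does \<open>n\<close> grow, until the reciprocal sum exceeds
    \<open>16 / e\<close> and the other term is also below \<open>e / 2\<close>.\<close>
  obtain K0 :: nat where K0: "8 / e < real K0" using reals_Archimedean2 by blast
  define K where "K = max 2 K0"
  have K: "2 \<le> K" "8 / e < real K" using K0 by (auto simp: K_def)
  then have K4: "4 / real K < e / 2" using e by (simp add: field_simps)
  have "fact K \<ge> (fact 2 :: nat)" using K(1) by (rule fact_mono)
  then have "(fact K :: nat) > 1" by simp
  then have "filterlim (\<lambda>n. \<Sum>l\<in>long_nondivisors (fact K) n. 1 / real l) at_top sequentially"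
    by (rule sum_inverse_long_nondivisors_at_top)
  then have "eventually (\<lambda>n. (\<Sum>l\<in>long_nondivisors (fact K) n. 1 / real l) > 16 / e) sequentially"
    by (simp add: filterlim_at_top_dense)
  then obtain n0 where n0: "\<And>n. n \<ge> n0 \<Longrightarrow> (\<Sum>l\<in>long_nondivisors (fact K) n. 1 / real l) > 16 / e"
    unfolding eventually_sequentially by blast
  have "norm (p_prop n - 0) < e" if "n \<ge> n0" for n
  proof -
    let ?\<mu> = "\<Sum>l\<in>long_nondivisors (fact K) n. 1 / real l"
    have \<mu>: "?\<mu> > 16 / e" using n0 that by blast
    then have pos: "?\<mu> > 0" using e by (meson divide_pos_pos less_trans zero_less_numeral)
    have "8 / ?\<mu> < e / 2" using \<mu> pos e by (simp add: field_simps)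
    then have "p_prop n < e" using p_prop_le[OF K(1) pos] K4 by linarith
    moreover have "p_prop n \<ge> 0" unfolding p_prop_def by simp
    ultimately show ?thesis by simp
  qed
  then show "\<exists>n0. \<forall>n\<ge>n0. norm (p_prop n - 0) < e" by blast
qed

end
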